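(* Let $S \subseteq \mathbb{N}$ be a nontrivial (that is, $S \neq \{0\}$), not necessarily numerical, semigroup. Then there exist $d \geq 1$ and a matrix $A \in \mathrm{M}_d(\mathbb{Q})$ such that $\mathcal{S}(A) = S$.
   Context: $\mathbb{N} = \{0,1,2,\ldots\}$. A semigroup in $\mathbb{N}$ means a subset of $\mathbb{N}$ that contains $0$ and is closed under addition (its complement need not be finite). $\mathrm{M}_d(R)$ denotes the set of $d\times d$ matrices with entries in $R$. The exponent semigroup of $A \in \mathrm{M}_d(\mathbb{Q})$ is $\mathcal{S}(A) = \{ n \in \mathbb{N} : A^n \in \mathrm{M}_d(\mathbb{Z})\}$, where $A^0 = I$. *)

theory Defs
  imports "Jordan_Normal_Form.Matrix"
begin

definition nat_semigroup :: "nat set \<Rightarrow> bool" where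
  "nat_semigroup S \<longleftrightarrow> 0 \<in> S \<and> (\<forall>m\<in>S. \<forall>n\<in>S. m + n \<in> S)"

definition square_mats :: "nat \<Rightarrow> 'a set \<Rightarrow> 'a mat set" where
  "square_mats d R = {A \<in> carrier_mat d d. elements_mat A \<subseteq> R}"

(* Intended for square A. The integer matrices are taken inside the rational ones,
   so \<int> is the set of integers in rat. *)
definition exponent_semigroup :: "rat mat \<Rightarrow> nat set" where
  "exponent_semigroup A = {n. A ^\<^sub>m n \<in> square_mats (dim_row A) \<int>}"

end

theory Submission
  imports Defs
begin

text \<open>
  Fix a positive \<open>m \<in> S\<close>. The matrix \<open>A\<close> is an \<open>m\<close>-cycle with weights: it sends the basis vector
  \<open>e\<^sub>i\<close> to \<open>f (i + 1) / f i\<close> times \<open>e\<^sub>i\<^sub>+\<^sub>1\<close>, indices modulo \<open>m\<close>, where \<open>f\<close> is a nonvanishing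
  sequence of rationals with \<open>f (i + m) = c * f i\<close>. The weights telescope, so \<open>A ^ n\<close> sends
  \<open>e\<^sub>i\<close> to \<open>f (i + n) / f i\<close> times \<open>e\<^sub>i\<^sub>+\<^sub>n\<close> (lemma \<open>weighted_cycle_power\<close>), and \<open>A ^ n\<close> is
  integral exactly when all quotients \<open>f (i + n) / f i\<close> are integers. It remains to find an
  \<open>f\<close> for which this happens exactly for \<open>n \<in> S\<close>.

  If \<open>S\<close> meets every residue class modulo \<open>m\<close>, let \<open>w i\<close> be the least element of \<open>S\<close> in the class
  of \<open>i\<close> (the Apery set of \<open>S\<close>) and take \<open>f i = 2 powi ((i - w i) / m)\<close>. For \<open>n \<in> S\<close> one
  has \<open>w (i + n) \<le> w i + n\<close>, so the exponent does not decrease under \<open>i \<mapsto> i + n\<close>; for \<open>n \<notin> S\<close>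
  it drops from \<open>0\<close> at \<open>i = 0\<close> to a negative value at \<open>n\<close>.

  Powers of \<open>2\<close> obeying the rule \<open>f (i + m) = 2 * f i\<close> do not suffice in general. They make
  \<open>A ^ m\<close> equal to \<open>2\<close> times the identity, and then all large powers of \<open>A\<close> are integral,
  whereas a semigroup whose elements have a common divisor greater than \<open>1\<close> omits arbitrarily
  large numbers. A factor \<open>3\<close>, present
  exactly on the residue classes that meet \<open>S\<close>, repairs this: these classes are preserved by
  adding elements of \<open>S\<close>, and if \<open>n\<close> is outside them then \<open>f n / f 0\<close> has denominator divisible
  by \<open>3\<close>. For the powers of \<open>2\<close>, the set \<open>S\<close> is enlarged by all numbers in the missed classes,
  which gives every class a least element. Adding elements of \<open>S\<close> preserves the enlarged set
  because the residues of \<open>S\<close> form a finite monoid in \<open>\<int>/m\<close>, hence a group.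
\<close>

section \<open>Powers of weighted cycles\<close>

definition weighted_cycle :: "nat \<Rightarrow> (nat \<Rightarrow> 'a::field) \<Rightarrow> 'a mat" where
  "weighted_cycle m f =
     mat m m (\<lambda>(r, i). if r = Suc i mod m then f (Suc i) / f i else 0)"

lemma weighted_cycle_carrier [simp]: "weighted_cycle m f \<in> carrier_mat m m"
  by (simp add: weighted_cycle_def)

lemma quasiperiodic_quotient_mod:
  fixes f :: "nat \<Rightarrow> 'a::field"
  assumes nz: "\<And>i. f i \<noteq> 0" and per: "\<And>i. f (i + m) = c * f i"
  shows "f (k mod m + n) / f (k mod m) = f (k + n) / f k"
proof -
  have iter: "f (i + j * m) = c ^ j * f i" for i j
  proof (induction j)
    case (Suc j)
    then show ?case using per[of "i + j * m"] by (simp add: algebra_simps)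
  qed simp
  have "c \<noteq> 0" using per[of 0] nz by auto
  moreover have "f k = c ^ (k div m) * f (k mod m)"
    using iter[of "k mod m" "k div m"] by simp
  moreover have "f (k + n) = c ^ (k div m) * f (k mod m + n)"
    using iter[of "k mod m + n" "k div m"] by (simp add: algebra_simps)
  ultimately show ?thesis by simp
qed

lemma weighted_cycle_power:
  fixes f :: "nat \<Rightarrow> 'a::field"
  assumes nz: "\<And>i. f i \<noteq> 0" and per: "\<And>i. f (i + m) = c * f i"
    and r: "r < m" and i: "i < m"
  shows "(weighted_cycle m f ^\<^sub>m n) $$ (r, i) =
    (if r = (i + n) mod m then f (i + n) / f i else 0)"
  using i
proof (induction n arbitrary: i)
  case 0
  then show ?case using r nz by (auto simp: weighted_cycle_def)
next
  case (Suc n)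
  let ?A = "weighted_cycle m f" and ?k = "Suc i mod m"
  have m: "0 < m" using r by simp
  have "(?A ^\<^sub>m Suc n) $$ (r, i) = (\<Sum>k = 0..<m. (?A ^\<^sub>m n) $$ (r, k) * ?A $$ (k, i))"
    using r Suc.prems pow_carrier_mat[OF weighted_cycle_carrier[of m f], of n]
    by (auto simp: times_mat_def scalar_prod_def weighted_cycle_def intro!: sum.cong)
  also have "\<dots> = (\<Sum>k = 0..<m. if k = ?k then (?A ^\<^sub>m n) $$ (r, k) * (f (Suc i) / f i) else 0)"
    using Suc.prems by (intro sum.cong) (auto simp: weighted_cycle_def)
  also have "\<dots> = (?A ^\<^sub>m n) $$ (r, ?k) * (f (Suc i) / f i)"
    using m by (simp add: sum.delta)
  also have "\<dots> = (if r = (?k + n) mod m then f (?k + n) / f ?k else 0) * (f (Suc i) / f i)"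
    using Suc.IH[of ?k] m by simp
  also have "\<dots> = (if r = (i + Suc n) mod m then f (i + Suc n) / f i else 0)"
    unfolding quasiperiodic_quotient_mod[of f m c, OF nz per] mod_add_left_eq
    using nz[of "Suc i"] by simp
  finally show ?case .
qed

text \<open>The quotients depend on \<open>i\<close> only modulo \<open>m\<close>, so the finitely many entries of the power
  control them for all \<open>i\<close>.\<close>

lemma exponent_semigroup_weighted_cycle:
  fixes f :: "nat \<Rightarrow> rat"
  assumes nz: "\<And>i. f i \<noteq> 0" and per: "\<And>i. f (i + m) = c * f i" and m: "0 < m"
  shows "exponent_semigroup (weighted_cycle m f) = {n. \<forall>i. f (i + n) / f i \<in> \<int>}"
proof -
  note entry = weighted_cycle_power[of f m c, OF nz per]
  have dim: "dim_row (weighted_cycle m f) = m"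
    by (simp add: weighted_cycle_def)
  have "n \<in> exponent_semigroup (weighted_cycle m f) \<longleftrightarrow> (\<forall>i. f (i + n) / f i \<in> \<int>)" for n
  proof
    let ?P = "weighted_cycle m f ^\<^sub>m n"
    have P: "?P \<in> carrier_mat m m" by (intro pow_carrier_mat weighted_cycle_carrier)
    {
      assume "n \<in> exponent_semigroup (weighted_cycle m f)"
      then have el: "elements_mat ?P \<subseteq> \<int>"
        by (simp add: exponent_semigroup_def square_mats_def dim)
      show "\<forall>i. f (i + n) / f i \<in> \<int>"
      proof
        fix i
        have "?P $$ ((i mod m + n) mod m, i mod m) \<in> \<int>"
          using m by (intro subsetD[OF el] elements_matI[OF P]) auto
        then have "f (i mod m + n) / f (i mod m) \<in> \<int>"
          using entry[of "(i mod m + n) mod m" "i mod m" n] m by simp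
        then show "f (i + n) / f i \<in> \<int>"
          unfolding quasiperiodic_quotient_mod[of f m c, OF nz per] .
      qed
    next
      assume int: "\<forall>i. f (i + n) / f i \<in> \<int>"
      have "elements_mat ?P \<subseteq> \<int>"
      proof
        fix x
        assume "x \<in> elements_mat ?P"
        then obtain r i where "r < m" "i < m" "x = ?P $$ (r, i)"
          using elements_matD[of x ?P] unfolding carrier_matD[OF P] by blast
        then show "x \<in> \<int>" using entry[of r i n] int by simp
      qed
      then show "n \<in> exponent_semigroup (weighted_cycle m f)"
        using P by (simp add: exponent_semigroup_def square_mats_def dim)
    }
  qed
  then show ?thesis by blast
qed

section \<open>The weights attached to a semigroup\<close>

definition residue_hull :: "nat set \<Rightarrow> nat \<Rightarrow> nat set" where
  "residue_hull S m = {i. \<exists>s\<in>S. s mod m = i mod m}"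

text \<open>If \<open>S\<close> meets every class modulo \<open>m\<close>, this is the Apery set of \<open>S\<close>. The union with the
  complement of the hull makes the minimum exist in the other classes as well.\<close>

definition apery :: "nat set \<Rightarrow> nat \<Rightarrow> nat \<Rightarrow> nat" where
  "apery S m i = (LEAST t. t \<in> S \<union> - residue_hull S m \<and> t mod m = i mod m)"

definition weight :: "nat set \<Rightarrow> nat \<Rightarrow> nat \<Rightarrow> rat" where
  "weight S m i = 2 powi ((int i - int (apery S m i)) div int m)
     * (if i \<in> residue_hull S m then 3 else 1)"

lemma semigroup_mult_closed:
  assumes "nat_semigroup S" "s \<in> S"
  shows "k * s \<in> S"
  using assms by (induction k) (auto simp: nat_semigroup_def)

text \<open>The backward direction inverts \<open>s\<close> modulo \<open>m\<close> by \<open>(m - 1) * s\<close>, which is again in \<open>S\<close>.\<close>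

lemma residue_hull_add_iff:
  assumes S: "nat_semigroup S" and m: "0 < m" and s: "s \<in> S"
  shows "i + s \<in> residue_hull S m \<longleftrightarrow> i \<in> residue_hull S m"
proof
  assume "i + s \<in> residue_hull S m"
  then obtain u where u: "u \<in> S" "u mod m = (i + s) mod m"
    by (auto simp: residue_hull_def)
  have "u + (m - 1) * s \<in> S"
    using S u(1) semigroup_mult_closed[OF S s] by (simp add: nat_semigroup_def)
  moreover have "(u + (m - 1) * s) mod m = i mod m"
  proof -
    have "(u + (m - 1) * s) mod m = ((i + s) + (m - 1) * s) mod m"
      using u(2) by (intro mod_add_cong) auto
    also have "(i + s) + (m - 1) * s = i + m * s"
      using m by (cases m) auto
    finally show ?thesis by simp
  qed
  ultimately show "i \<in> residue_hull S m" by (auto simp: residue_hull_def)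
next
  assume "i \<in> residue_hull S m"
  then obtain u where "u \<in> S" "u mod m = i mod m" by (auto simp: residue_hull_def)
  then have "u + s \<in> S" "(u + s) mod m = (i + s) mod m"
    using S s by (auto simp: nat_semigroup_def intro: mod_add_cong)
  then show "i + s \<in> residue_hull S m" by (auto simp: residue_hull_def)
qed

lemma apery_mem: "apery S m i \<in> S \<union> - residue_hull S m"
  and apery_mod: "apery S m i mod m = i mod m"
proof -
  have "\<exists>t. t \<in> S \<union> - residue_hull S m \<and> t mod m = i mod m"
    by (cases "i \<in> residue_hull S m") (auto simp: residue_hull_def)
  then have "apery S m i \<in> S \<union> - residue_hull S m \<and> apery S m i mod m = i mod m"
    unfolding apery_def by (rule LeastI_ex)
  then show "apery S m i \<in> S \<union> - residue_hull S m" "apery S m i mod m = i mod m" by auto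
qed

lemma apery_le:
  assumes "t \<in> S \<union> - residue_hull S m" "t mod m = i mod m"
  shows "apery S m i \<le> t"
  unfolding apery_def by (rule Least_le) (use assms in simp)

lemma apery_add_le:
  assumes S: "nat_semigroup S" and m: "0 < m" and s: "s \<in> S"
  shows "apery S m (i + s) \<le> apery S m i + s"
proof (rule apery_le)
  show "apery S m i + s \<in> S \<union> - residue_hull S m"
    using apery_mem[of S m i] residue_hull_add_iff[OF S m s] S s
    by (auto simp: nat_semigroup_def)
  show "(apery S m i + s) mod m = (i + s) mod m"
    by (intro mod_add_cong apery_mod refl)
qed

text \<open>Within a class that meets \<open>S\<close>, the elements of \<open>S\<close> are exactly the numbers from the minimum
  onwards, since \<open>m\<close> itself can be added.\<close>

lemma less_apery:
  assumes S: "nat_semigroup S" and m: "m \<in> S" and n: "n \<in> residue_hull S m" "n \<notin> S"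
  shows "n < apery S m n"
proof (rule ccontr)
  assume "\<not> n < apery S m n"
  then have le: "apery S m n \<le> n" by simp
  have "apery S m n \<in> residue_hull S m"
    using n(1) apery_mod[of S m n] by (auto simp: residue_hull_def)
  then have mem: "apery S m n \<in> S" using apery_mem[of S m n] by auto
  have "m dvd n - apery S m n"
    using apery_mod[of S m n] mod_eq_dvd_iff_nat[OF le, of m] by simp
  then obtain k where "n - apery S m n = k * m" by (metis dvd_def mult.commute)
  then have "n = apery S m n + k * m" using le by simp
  then have "n \<in> S"
    using S mem semigroup_mult_closed[OF S m] by (metis nat_semigroup_def)
  with n(2) show False by simp
qed

lemma weight_pos: "weight S m i > 0"
  by (simp add: weight_def zero_less_power_int)

lemma weight_add_period:
  assumes m: "0 < m"
  shows "weight S m (i + m) = 2 * weight S m i"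
proof -
  have "apery S m (i + m) = apery S m i" by (simp add: apery_def)
  moreover have "i + m \<in> residue_hull S m \<longleftrightarrow> i \<in> residue_hull S m"
    by (simp add: residue_hull_def)
  moreover have "(int (i + m) - int a) div int m = (int i - int a) div int m + 1" for a
    using m div_add_self2[of "int m" "int i - int a"] by (simp add: algebra_simps)
  ultimately show ?thesis by (simp add: weight_def power_int_add)
qed

lemma weight_zero:
  assumes "0 \<in> S"
  shows "weight S m 0 = 3"
proof -
  have "apery S m 0 \<le> 0" by (rule apery_le) (use assms in auto)
  moreover have "0 \<in> residue_hull S m" using assms unfolding residue_hull_def by blast
  ultimately show ?thesis by (simp add: weight_def)
qed

lemma weight_quotient_integral:
  assumes S: "nat_semigroup S" and m: "0 < m" and n: "n \<in> S"
  shows "weight S m (i + n) / weight S m i \<in> \<int>"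
proof -
  let ?h = "\<lambda>i. (int i - int (apery S m i)) div int m"
  have "?h i \<le> ?h (i + n)"
    using apery_add_le[OF S m n, of i] m by (intro zdiv_mono1) auto
  then have "(2 :: rat) powi (?h (i + n) - ?h i) \<in> \<int>"
    by (auto simp: power_int_def)
  moreover have "weight S m (i + n) / weight S m i = 2 powi (?h (i + n) - ?h i)"
    using residue_hull_add_iff[OF S m n, of i] by (simp add: weight_def power_int_diff)
  ultimately show ?thesis by simp
qed

lemma not_Ints_between_0_1:
  fixes x :: "'a::linordered_idom"
  assumes "0 < x" "x < 1"
  shows "x \<notin> \<int>"
  using assms by (auto elim!: Ints_cases)

lemma power_int_two_third_not_Ints: "(2 :: rat) powi z / 3 \<notin> \<int>"
proof (cases "z \<ge> 0")
  case True
  show ?thesis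
  proof
    assume "(2 :: rat) powi z / 3 \<in> \<int>"
    then obtain k where "(2 :: rat) ^ nat z / 3 = of_int k"
      using True by (auto simp: power_int_def elim: Ints_cases)
    then have "of_int (2 ^ nat z) = (of_int (3 * k) :: rat)"
      by (simp add: field_simps)
    then have "(2 :: int) ^ nat z = 3 * k" by (simp only: of_int_eq_iff)
    then have "(3 :: int) dvd 2 ^ nat z" by simp
    moreover have "coprime (3 :: int) (2 ^ nat z)"
      by simp
    ultimately show False
      using coprime_common_divisor[of 3 "2 ^ nat z" "3 :: int"] by simp
  qed
next
  case False
  then have "(2 :: rat) powi z \<le> 2 powi 0" by (intro power_int_increasing) auto
  then show ?thesis by (intro not_Ints_between_0_1) (auto simp: zero_less_power_int)
qed

text \<open>The index \<open>0\<close> already detects \<open>n \<notin> S\<close>: the prime \<open>3\<close> if \<open>n\<close> lies in a class that misses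
  \<open>S\<close>, the prime \<open>2\<close> otherwise.\<close>

lemma weight_quotient_not_integral:
  assumes S: "nat_semigroup S" and m: "m \<in> S" "0 < m" and n: "n \<notin> S"
  shows "weight S m n / weight S m 0 \<notin> \<int>"
proof -
  have w0: "weight S m 0 = 3" using S by (intro weight_zero) (simp add: nat_semigroup_def)
  show ?thesis
  proof (cases "n \<in> residue_hull S m")
    case True
    let ?h = "(int n - int (apery S m n)) div int m"
    have "?h < 0"
      using less_apery[OF S m(1) True n] m(2) by (intro div_neg_pos_less0) auto
    then have "(2 :: rat) powi ?h < 2 powi 0" by (intro power_int_strict_increasing) auto
    moreover have "weight S m n / weight S m 0 = 2 powi ?h"
      using True unfolding w0 by (simp add: weight_def)
    ultimately show ?thesis by (intro not_Ints_between_0_1) (auto simp: zero_less_power_int)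
  next
    case False
    then show ?thesis
      using power_int_two_third_not_Ints unfolding w0 by (simp add: weight_def)
  qed
qed

section \<open>Every nontrivial semigroup is an exponent semigroup\<close>

theorem corollary6p5:
  fixes S :: "nat set"
  assumes "nat_semigroup S" and "S \<noteq> {0}"
  shows "\<exists>d\<ge>1. \<exists>A \<in> square_mats d (UNIV :: rat set). exponent_semigroup A = S"
proof -
  have "\<exists>m\<in>S. m \<noteq> 0"
  proof (rule ccontr)
    assume "\<not> (\<exists>m\<in>S. m \<noteq> 0)"
    moreover have "0 \<in> S" using assms(1) unfolding nat_semigroup_def by (rule conjunct1)
    ultimately have "S = {0}" by blast
    with assms(2) show False by contradiction
  qed
  then obtain m where m: "m \<in> S" "m \<noteq> 0" by (elim bexE)
  then have m0: "0 < m" by simp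
  let ?f = "weight S m"
  have "exponent_semigroup (weighted_cycle m ?f) = {n. \<forall>i. ?f (i + n) / ?f i \<in> \<int>}"
  proof (rule exponent_semigroup_weighted_cycle)
    show "?f i \<noteq> 0" for i using weight_pos[of S m i] by simp
  qed (rule weight_add_period[OF m0] m0)+
  also have "\<dots> = S"
  proof (intro Set.set_eqI iffI)
    fix n
    assume "n \<in> {n. \<forall>i. ?f (i + n) / ?f i \<in> \<int>}"
    then have "?f (0 + n) / ?f 0 \<in> \<int>" by blast
    then show "n \<in> S"
      using weight_quotient_not_integral[OF assms(1) m(1) m0] by auto
  next
    fix n
    assume "n \<in> S"
    then show "n \<in> {n. \<forall>i. ?f (i + n) / ?f i \<in> \<int>}"
      using weight_quotient_integral[OF assms(1) m0] by blast
  qed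
  finally have "exponent_semigroup (weighted_cycle m ?f) = S" .
  moreover have "weighted_cycle m ?f \<in> square_mats m UNIV"
    by (simp add: square_mats_def)
  ultimately show ?thesis using m0 by (intro exI[of _ m]) auto
qed

end
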